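(* Let $X$ be a standard Markov process in $\mathbb{R}^d$, let $C\subseteq\mathbb{R}^d$ be the (open) continuation set and $D=\mathbb{R}^d\setminus C$ the (closed) stopping set. If $x\in\partial C$ is probabilistically regular for $D$ and $X$ is strong Feller, then $x$ is Green regular for $D$.
   Context: $X$ is a standard Markov process in the sense of Blumenthal--Getoor (strong Markov, right-continuous with left limits, left-continuous over stopping times), started at $x$ under $\mathsf P_x$, adapted to a right-continuous filtration. $C=\{V>G\}$ and $D=\{V=G\}$ are the continuation and stopping sets of an optimal stopping problem with value function $V$ and gain function $G$; all that matters here is that $C$ is open and $D=\mathbb{R}^d\setminus C$ is closed. $\tau_D=\inf\{t\ge0:X_t\in D\}$ is the first entry time and $\sigma_D=\inf\{t>0:X_t\in D\}$ the first hitting time. Strong Feller: $x\mapsto\mathsf E_x[F(X_t)]$ is continuous for every bounded measurable $F:\mathbb{R}^d\to\mathbb{R}$ and every $t>0$. $z\in\partial C$ is probabilistically regular for $D$ if $\mathsf P_z(\sigma_D=0)=1$. $z\in\partial C$ is Green regular for $D$ if $\lim_{C\ni x\to z}\mathsf P_x(\tau_D\ge\varepsilon)=0$ for each $\varepsilon>0$. *)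

theory Defs
  imports "HOL-Probability.Probability"
begin

section \<open>The augmented state space\<close>

text \<open>
  The state space is \<open>E = 'a\<close>, a Euclidean space. Since \<open>E\<close> is not compact, the cemetery
  \<open>\<Delta> = None\<close> is adjoined as the point at infinity.
\<close>

definition aug_top :: "'a::euclidean_space option topology" where
  "aug_top = Alexandroff_compactification euclidean"

definition aug_borel :: "'a::euclidean_space option measure" where
  "aug_borel = sigma UNIV {U. openin aug_top U}"


section \<open>Null sets and completion relative to all initial laws\<close>

text \<open>
  For a family \<open>P\<close> of probability measures on \<open>M\<close> and a law \<open>\<mu>\<close> on the augmented state space,
  a set \<open>N\<close> is null for \<open>P\<^sup>\<mu> = \<integral> P\<^sup>x d\<mu>(x)\<close> iff \<open>P\<^sup>x(N) = 0\<close> for \<open>\<mu>\<close>-almost every \<open>x\<close>.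
\<close>

definition initial_laws :: "'a::euclidean_space option measure set" where
  "initial_laws = {\<mu>. prob_space \<mu> \<and> sets \<mu> = sets aug_borel}"

definition law_null_sets ::
  "'w measure \<Rightarrow> ('a::euclidean_space option \<Rightarrow> 'w measure) \<Rightarrow> 'a option measure \<Rightarrow> 'w set set" where
  "law_null_sets M P \<mu> = {N \<in> sets M. AE x in \<mu>. emeasure (P x) N = 0}"

definition almost_surely ::
  "'w measure \<Rightarrow> ('a::euclidean_space option \<Rightarrow> 'w measure) \<Rightarrow> ('w \<Rightarrow> bool) \<Rightarrow> bool" where
  "almost_surely M P Q \<longleftrightarrow>
     (\<forall>\<mu>\<in>initial_laws. \<exists>N\<in>law_null_sets M P \<mu>. {\<omega> \<in> space M. \<not> Q \<omega>} \<subseteq> N)"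

text \<open>
  \<open>G\<close> equals its completion in \<open>M\<close>: it contains every set that, for each initial law \<open>\<mu>\<close>,
  differs from some element of \<open>G\<close> (depending on \<open>\<mu>\<close>) by a subset of a \<open>P\<^sup>\<mu>\<close>-null set.
\<close>

definition complete_in ::
  "'w measure \<Rightarrow> ('a::euclidean_space option \<Rightarrow> 'w measure) \<Rightarrow> 'w measure \<Rightarrow> bool" where
  "complete_in M P G \<longleftrightarrow>
     (\<forall>A \<subseteq> space M.
        (\<forall>\<mu>\<in>initial_laws. \<exists>B\<in>sets G. \<exists>N\<in>law_null_sets M P \<mu>. sym_diff A B \<subseteq> N)
        \<longrightarrow> A \<in> sets G)"


section \<open>Standard Markov processes\<close>

definition lifetime :: "(ennreal \<Rightarrow> 'w \<Rightarrow> 'a option) \<Rightarrow> 'w \<Rightarrow> ennreal" where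
  "lifetime X \<omega> = Inf {t. X t \<omega> = None}"

text \<open>
  Standard processes in the sense of Blumenthal and Getoor. The time set is \<open>[0,\<infinity>]\<close>, with the
  convention \<open>X\<^sub>\<infinity> = \<Delta>\<close>; a process with values in \<open>E\<close> at all finite times is the case of infinite
  lifetime. Left limits are required in the augmented space, before the lifetime. The Markov
  property at fixed times is \<open>strong_markov\<close> for constant stopping times.
\<close>

locale standard_process = filtration "space M" F
  for M :: "'w measure" and F :: "ennreal \<Rightarrow> 'w measure" +
  fixes X :: "ennreal \<Rightarrow> 'w \<Rightarrow> 'a::euclidean_space option"
    and \<theta> :: "ennreal \<Rightarrow> 'w \<Rightarrow> 'w"
    and P :: "'a option \<Rightarrow> 'w measure"
  assumes sets_F_subset: "\<And>t. sets (F t) \<subseteq> sets M"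
    and right_continuous_F: "\<And>t. t < \<infinity> \<Longrightarrow> sets (F t) = (\<Inter>s\<in>{t<..}. sets (F s))"
    and complete_M: "complete_in M P M"
    and complete_F: "\<And>t. complete_in M P (F t)"
    and prob_space_P: "\<And>x. prob_space (P x)"
    and sets_P: "\<And>x. sets (P x) = sets M"
    and adapted: "\<And>t. X t \<in> F t \<rightarrow>\<^sub>M aug_borel"
    and measurable_P: "\<And>t B. B \<in> sets aug_borel \<Longrightarrow>
      (\<lambda>x. emeasure (P x) {\<omega> \<in> space M. X t \<omega> \<in> B}) \<in> borel_measurable aug_borel"
    and normal: "\<And>x. AE \<omega> in P x. X 0 \<omega> = x"
    and at_infinity: "\<And>\<omega>. \<omega> \<in> space M \<Longrightarrow> X \<infinity> \<omega> = None"
    and absorbing: "\<And>\<omega> s t. \<lbrakk>\<omega> \<in> space M; s \<le> t; X s \<omega> = None\<rbrakk> \<Longrightarrow> X t \<omega> = None"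
    and shift_space: "\<And>h \<omega>. \<omega> \<in> space M \<Longrightarrow> \<theta> h \<omega> \<in> space M"
    and shift: "\<And>h t \<omega>. \<omega> \<in> space M \<Longrightarrow> X t (\<theta> h \<omega>) = X (t + h) \<omega>"
    and right_continuous: "almost_surely M P
      (\<lambda>\<omega>. \<forall>t<\<infinity>. limitin aug_top (\<lambda>s. X s \<omega>) (X t \<omega>) (at_right t))"
    and left_limits: "almost_surely M P
      (\<lambda>\<omega>. \<forall>t. 0 < t \<and> t < lifetime X \<omega> \<longrightarrow> (\<exists>l. limitin aug_top (\<lambda>s. X s \<omega>) l (at_left t)))"
    and stopped_measurable: "\<And>T. stopping_time F T \<Longrightarrow>
      (\<lambda>\<omega>. X (T \<omega>) \<omega>) \<in> pre_sigma T \<rightarrow>\<^sub>M aug_borel"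
    and strong_markov: "\<And>T t f x. \<lbrakk>stopping_time F T; f \<in> borel_measurable aug_borel; bounded (range f)\<rbrakk> \<Longrightarrow>
      AE \<omega> in P x. real_cond_exp (P x) (pre_sigma T) (\<lambda>\<omega>. f (X (T \<omega> + t) \<omega>)) \<omega>
                 = (\<integral>\<omega>'. f (X t \<omega>') \<partial>P (X (T \<omega>) \<omega>))"
    and quasi_left_continuous: "\<And>T. \<lbrakk>\<And>n. stopping_time F (T n); \<And>\<omega>. \<omega> \<in> space M \<Longrightarrow> incseq (\<lambda>n. T n \<omega>)\<rbrakk> \<Longrightarrow>
      almost_surely M P (\<lambda>\<omega>. (SUP n. T n \<omega>) < lifetime X \<omega> \<longrightarrow>
        limitin aug_top (\<lambda>n. X (T n \<omega>) \<omega>) (X (SUP n. T n \<omega>) \<omega>) sequentially)"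

text \<open>Functions on \<open>E\<close> are extended by \<open>F(\<Delta>) = 0\<close>.\<close>

definition strong_feller ::
  "(ennreal \<Rightarrow> 'w \<Rightarrow> 'a::euclidean_space option) \<Rightarrow> ('a option \<Rightarrow> 'w measure) \<Rightarrow> bool" where
  "strong_feller X P \<longleftrightarrow>
     (\<forall>f :: 'a \<Rightarrow> real. \<forall>t. f \<in> borel_measurable borel \<and> bounded (range f) \<and> 0 < t \<and> t < \<infinity> \<longrightarrow>
        continuous_on UNIV
          (\<lambda>x. \<integral>\<omega>. (case X t \<omega> of None \<Rightarrow> 0 | Some y \<Rightarrow> f y) \<partial>P (Some x)))"


section \<open>Entry and hitting times, regularity of boundary points\<close>

text \<open>Infima of empty sets are \<open>\<infinity>\<close> in \<^typ>\<open>ennreal\<close>.\<close>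

definition entry_time :: "(ennreal \<Rightarrow> 'w \<Rightarrow> 'a option) \<Rightarrow> 'a set \<Rightarrow> 'w \<Rightarrow> ennreal" where
  "entry_time X D \<omega> = Inf {t. X t \<omega> \<in> Some ` D}"

definition hitting_time :: "(ennreal \<Rightarrow> 'w \<Rightarrow> 'a option) \<Rightarrow> 'a set \<Rightarrow> 'w \<Rightarrow> ennreal" where
  "hitting_time X D \<omega> = Inf {t. 0 < t \<and> X t \<omega> \<in> Some ` D}"

text \<open>
  The events below are measurable for a standard process and closed \<open>D\<close>, because the
  filtration is complete and the paths are quasi-left-continuous.
\<close>

definition probabilistically_regular ::
  "(ennreal \<Rightarrow> 'w \<Rightarrow> 'a option) \<Rightarrow> ('a option \<Rightarrow> 'w measure) \<Rightarrow> 'a::euclidean_space set \<Rightarrow> 'a \<Rightarrow> bool" where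
  "probabilistically_regular X P D z \<longleftrightarrow>
     \<P>(\<omega> in P (Some z). hitting_time X D \<omega> = 0) = 1"

definition green_regular ::
  "(ennreal \<Rightarrow> 'w \<Rightarrow> 'a option) \<Rightarrow> ('a option \<Rightarrow> 'w measure) \<Rightarrow> 'a::euclidean_space set \<Rightarrow> 'a set \<Rightarrow> 'a \<Rightarrow> bool" where
  "green_regular X P C D z \<longleftrightarrow>
     (\<forall>\<epsilon>::real. 0 < \<epsilon> \<longrightarrow>
        ((\<lambda>x. \<P>(\<omega> in P (Some x). entry_time X D \<omega> \<ge> ennreal \<epsilon>)) \<longlongrightarrow> 0) (at z within C))"

end

theory Submission
  imports Defs
begin

text \<open>
  For small \<open>\<delta> > 0\<close> let \<open>H\<^sub>\<delta>\<close> be the event that \<open>X\<close> visits \<open>D\<close> during \<open>[\<delta>, \<epsilon>)\<close>. By the Markov property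
  at time \<open>\<delta>\<close> and the strong Feller property, \<open>P\<^sub>y(H\<^sub>\<delta>)\<close> is continuous in \<open>y\<close>; moreover
  \<open>P\<^sub>y(\<tau>\<^sub>D \<ge> \<epsilon>) \<le> 1 - P\<^sub>y(H\<^sub>\<delta>)\<close>. As \<open>\<delta>\<close> tends to \<open>0\<close>, the right-hand side at a regular point \<open>z\<close> tends
  to \<open>0\<close>, so \<open>y \<mapsto> P\<^sub>y(\<tau>\<^sub>D \<ge> \<epsilon>)\<close> lies below continuous functions with arbitrarily small value at \<open>z\<close>.

  The strong Feller property needs a Borel function of \<open>X\<^sub>\<delta>\<close>, so \<open>H\<^sub>\<delta>\<close> is expressed through the path
  at countably many times: at rational times before \<open>\<epsilon>\<close> the path comes arbitrarily close to \<open>D\<close>. By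
  quasi-left-continuity this forces an actual visit, at the supremum of the entry times into
  shrinking neighbourhoods of \<open>D\<close>.
\<close>

section \<open>Borel sets of the augmented state space\<close>

lemma space_aug_borel [simp]: "space aug_borel = UNIV"
  by (simp add: aug_borel_def space_measure_of_conv)

lemma sets_aug_borelI: "openin aug_top U \<Longrightarrow> U \<in> sets aug_borel"
  by (simp add: aug_borel_def)

lemma openin_aug_top_Some_image: "open U \<Longrightarrow> openin aug_top (Some ` U)"
  by (simp add: aug_top_def open_openin[symmetric])

lemma Some_image_in_sets_aug_borel: "open U \<Longrightarrow> Some ` U \<in> sets aug_borel"
  by (intro sets_aug_borelI openin_aug_top_Some_image)

text \<open>Pulls functions on the augmented space back to Borel functions on \<open>'a\<close>, the
  kind that \<open>strong_feller\<close> speaks of.\<close>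

lemma measurable_Some_aug_borel: "Some \<in> borel \<rightarrow>\<^sub>M aug_borel"
  unfolding aug_borel_def
proof (rule measurable_measure_of)
  fix U :: "'a option set" assume "U \<in> {U. openin aug_top U}"
  then have "openin euclidean {x \<in> topspace euclidean. Some x \<in> U}"
    using continuous_map_Some[of "euclidean :: 'a topology"] unfolding continuous_map_def aug_top_def by blast
  then have "open (Some -` U)" by (simp add: vimage_def open_openin[symmetric])
  then show "Some -` U \<inter> space borel \<in> sets borel" by simp
qed auto

section \<open>The Markov property at fixed times and for finitely many observations\<close>

context standard_process
begin

lemma space_P: "space (P y) = space M"
  using sets_eq_imp_space_eq[OF sets_P] .

lemma measurable_from_F: "f \<in> F t \<rightarrow>\<^sub>M N \<Longrightarrow> t \<le> s \<Longrightarrow> f \<in> F s \<rightarrow>\<^sub>M N"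
  using measurable_mono[of N N "F t" "F s"] sets_F_mono[of t s] by (auto simp: space_F)

lemma measurable_F_imp_M: "f \<in> F t \<rightarrow>\<^sub>M N \<Longrightarrow> f \<in> M \<rightarrow>\<^sub>M N"
  using measurable_mono[of N N "F t" M] sets_F_subset[of t] by (auto simp: space_F)

lemma measurable_M_imp_P: "f \<in> M \<rightarrow>\<^sub>M N \<Longrightarrow> f \<in> P y \<rightarrow>\<^sub>M N"
  using measurable_cong_sets[OF sets_P refl] by blast

lemma measurable_X: "X t \<in> M \<rightarrow>\<^sub>M aug_borel"
  using measurable_F_imp_M[OF adapted] .

lemma pred_X_in:
  assumes "B \<in> sets aug_borel" shows "Measurable.pred M (\<lambda>\<omega>. X t \<omega> \<in> B)"
  by (rule pred_sets2[OF assms measurable_X])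

text \<open>By \<open>measurable_P\<close> the laws of \<open>X t\<close> form a kernel into
  \<open>subprob_algebra\<close>, and integrating a measurable function against a kernel is
  measurable in the starting point.\<close>

lemma transition_measurable:
  fixes f :: "'a option \<Rightarrow> real"
  assumes f: "f \<in> borel_measurable aug_borel"
  shows "(\<lambda>x. \<integral>\<omega>. f (X t \<omega>) \<partial>P x) \<in> borel_measurable aug_borel"
proof -
  have X: "X t \<in> P x \<rightarrow>\<^sub>M aug_borel" for x
    by (rule measurable_M_imp_P[OF measurable_X])
  have "(\<lambda>x. distr (P x) aug_borel (X t)) \<in> aug_borel \<rightarrow>\<^sub>M subprob_algebra aug_borel"
  proof (rule measurable_subprob_algebra)
    fix x
    show "subprob_space (distr (P x) aug_borel (X t))"
      by (intro prob_space_imp_subprob_space prob_space.prob_space_distr prob_space_P X)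
  next
    fix B assume B: "B \<in> sets (aug_borel :: 'a option measure)"
    have "emeasure (distr (P x) aug_borel (X t)) B = emeasure (P x) {\<omega> \<in> space M. X t \<omega> \<in> B}" for x
      by (subst emeasure_distr[OF X B]) (auto simp: space_P intro!: arg_cong[where f="emeasure _"])
    then show "(\<lambda>x. emeasure (distr (P x) aug_borel (X t)) B) \<in> borel_measurable aug_borel"
      using measurable_P[OF B] by simp
  qed auto
  from measurable_compose[OF this integral_measurable_subprob_algebra[OF f]]
  show ?thesis by (simp add: integral_distr[OF X f])
qed

text \<open>The strong Markov property at the constant time \<open>s\<close>, tested against a
  weight \<open>Z\<close> known at time \<open>s\<close>. The weight later collects the observations
  made up to \<open>s\<close>.\<close>

lemma markov_property:
  fixes f :: "'a option \<Rightarrow> real"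
  assumes Z: "Z \<in> borel_measurable (F s)" "\<And>\<omega>. \<bar>Z \<omega>\<bar> \<le> 1"
    and f: "f \<in> borel_measurable aug_borel" "\<And>x. \<bar>f x\<bar> \<le> 1"
  shows "(\<integral>\<omega>. Z \<omega> * f (X (s + t) \<omega>) \<partial>P y) = (\<integral>\<omega>. Z \<omega> * (\<integral>\<omega>'. f (X t \<omega>') \<partial>P (X s \<omega>)) \<partial>P y)"
proof -
  interpret prob_space "P y" by (rule prob_space_P)
  let ?G = "pre_sigma (\<lambda>_. s)"
  have st: "stopping_time F (\<lambda>_. s)" by (rule stopping_time_const)
  \<comment> \<open>This inclusion makes \<open>Z\<close> measurable for \<open>?G\<close>, hence an
    admissible test function for the conditional expectation.\<close>
  have sets_G: "sets (F s) \<subseteq> sets ?G"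
    using sets_F_mono by (auto intro!: sets_pre_sigmaI[OF st] split: if_splits simp: subset_eq Collect_conj_eq)
  have subalg: "subalgebra (P y) ?G"
    unfolding subalgebra_def
  proof (intro conjI subsetI)
    show "space ?G = space (P y)" by (simp add: space_pre_sigma space_P)
    fix A assume "A \<in> sets ?G"
    from sets_pre_sigmaD[OF st this, of s] show "A \<in> sets (P y)"
      using sets_F_subset[of s] by (auto simp: sets_P)
  qed
  interpret finite_measure_subalgebra "P y" ?G
    by unfold_locales (rule subalg)
  have ZG: "Z \<in> borel_measurable ?G"
    using measurable_mono[of borel borel "F s" ?G] sets_G Z(1) by (auto simp: space_F space_pre_sigma)
  have Zm: "Z \<in> borel_measurable (P y)"
    by (rule measurable_M_imp_P[OF measurable_F_imp_M[OF Z(1)]])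
  have gm: "(\<lambda>\<omega>. f (X (s + t) \<omega>)) \<in> borel_measurable (P y)"
    by (rule measurable_M_imp_P[OF measurable_compose[OF measurable_X f(1)]])
  have km: "(\<lambda>\<omega>. \<integral>\<omega>'. f (X t \<omega>') \<partial>P (X s \<omega>)) \<in> borel_measurable (P y)"
    by (rule measurable_M_imp_P[OF measurable_compose[OF measurable_X transition_measurable[OF f(1)]]])
  have int: "integrable (P y) (\<lambda>\<omega>. Z \<omega> * f (X (s + t) \<omega>))"
  proof (rule integrable_const_bound[where B=1])
    have "\<bar>Z \<omega> * f (X (s + t) \<omega>)\<bar> \<le> 1 * 1" for \<omega>
      unfolding abs_mult by (intro mult_mono Z f) auto
    then show "AE \<omega> in P y. norm (Z \<omega> * f (X (s + t) \<omega>)) \<le> 1" by simp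
  qed (use Zm gm in measurable)
  have "bounded (range f)" using f(2) by (auto simp: bounded_iff)
  then have ae: "AE \<omega> in P y. real_cond_exp (P y) ?G (\<lambda>\<omega>. f (X (s + t) \<omega>)) \<omega>
                 = (\<integral>\<omega>'. f (X t \<omega>') \<partial>P (X s \<omega>))"
    using strong_markov[OF st f(1)] by simp
  have "(\<integral>\<omega>. Z \<omega> * f (X (s + t) \<omega>) \<partial>P y)
      = (\<integral>\<omega>. Z \<omega> * real_cond_exp (P y) ?G (\<lambda>\<omega>. f (X (s + t) \<omega>)) \<omega> \<partial>P y)"
    by (rule real_cond_exp_intg(2)[OF int ZG gm, symmetric])
  also have "\<dots> = (\<integral>\<omega>. Z \<omega> * (\<integral>\<omega>'. f (X t \<omega>') \<partial>P (X s \<omega>)) \<partial>P y)"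
    using ae Zm km by (intro integral_cong_AE) auto
  finally show ?thesis .
qed

text \<open>The time \<open>r\<close> is the origin from which the observation times in \<open>J\<close> are counted; it moves
  forward as the earliest observation is removed from \<open>J\<close>.\<close>

lemma finite_dimensional_markov:
  fixes J :: "real set"
  assumes "finite J" "\<And>t. B t \<in> sets aug_borel" "\<And>t. t \<in> J \<Longrightarrow> r \<le> t"
  shows "\<exists>u :: 'a option \<Rightarrow> real. u \<in> borel_measurable aug_borel \<and> (\<forall>x. \<bar>u x\<bar> \<le> 1) \<and>
    (\<forall>y s Z. 0 \<le> s \<longrightarrow> Z \<in> borel_measurable (F (ennreal s)) \<longrightarrow> (\<forall>\<omega>. \<bar>Z \<omega>\<bar> \<le> 1) \<longrightarrow>
      (\<integral>\<omega>. Z \<omega> * (\<Prod>t\<in>J. indicator (B t) (X (ennreal (s + (t - r))) \<omega>)) \<partial>P y)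
        = (\<integral>\<omega>. Z \<omega> * u (X (ennreal s) \<omega>) \<partial>P y))"
  using assms(1,3)
proof (induction J arbitrary: r rule: finite_linorder_min_induct)
  case empty
  show ?case by (intro exI[of _ "\<lambda>_. 1"]) auto
next
  case (insert b J)
  have "b \<le> t" if "t \<in> J" for t using insert.hyps(2) that by auto
  from insert.IH[OF this] obtain u :: "'a option \<Rightarrow> real" where u: "u \<in> borel_measurable aug_borel" "\<And>x. \<bar>u x\<bar> \<le> 1"
    and IH: "\<And>y s Z. 0 \<le> s \<Longrightarrow> Z \<in> borel_measurable (F (ennreal s)) \<Longrightarrow> (\<And>\<omega>. \<bar>Z \<omega>\<bar> \<le> 1) \<Longrightarrow>
      (\<integral>\<omega>. Z \<omega> * (\<Prod>t\<in>J. indicator (B t) (X (ennreal (s + (t - b))) \<omega>)) \<partial>P y)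
        = (\<integral>\<omega>. Z \<omega> * u (X (ennreal s) \<omega>) \<partial>P y)"
    by blast
  have rb: "r \<le> b" using insert.prems by auto
  let ?f = "\<lambda>x. indicator (B b) x * u x"
  have f: "?f \<in> borel_measurable aug_borel" "\<And>x. \<bar>?f x\<bar> \<le> 1"
    using u assms(2)[of b] by (auto simp: indicator_def abs_mult)
  \<comment> \<open>\<open>u\<close> accounts for the observations after \<open>b\<close> and
    \<open>?f\<close> adds the one at \<open>b\<close>; averaging over the waiting time
    \<open>b - r\<close> moves the origin from \<open>b\<close> back to \<open>r\<close>.\<close>
  let ?v = "\<lambda>x. \<integral>\<omega>. ?f (X (ennreal (b - r)) \<omega>) \<partial>P x"
  have "\<bar>?v x\<bar> \<le> 1" for x
  proof -
    interpret prob_space "P x" by (rule prob_space_P)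
    have "norm (?v x) \<le> (\<integral>\<omega>. norm (?f (X (ennreal (b - r)) \<omega>)) \<partial>P x)" by (rule integral_norm_bound)
    also have "\<dots> \<le> (\<integral>\<omega>. 1 \<partial>P x)"
    proof (rule integral_mono)
      show "integrable (P x) (\<lambda>\<omega>. norm (?f (X (ennreal (b - r)) \<omega>)))"
        using f(2) measurable_M_imp_P[OF measurable_compose[OF measurable_X f(1)]]
        by (intro integrable_norm integrable_const_bound[where B=1]) auto
    qed (use f(2) in auto)
    also have "\<dots> = 1" by (simp add: prob_space)
    finally show ?thesis by simp
  qed
  moreover have "(\<integral>\<omega>. Z \<omega> * (\<Prod>t\<in>insert b J. indicator (B t) (X (ennreal (s + (t - r))) \<omega>)) \<partial>P y)
        = (\<integral>\<omega>. Z \<omega> * ?v (X (ennreal s) \<omega>) \<partial>P y)"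
    if s: "0 \<le> s" and Z: "Z \<in> borel_measurable (F (ennreal s))" "\<And>\<omega>. \<bar>Z \<omega>\<bar> \<le> 1" for y s Z
  proof -
    let ?s = "s + (b - r)"
    \<comment> \<open>The observation at \<open>b\<close> is known at time \<open>?s\<close>, so its
      indicator joins the weight, and the induction hypothesis with origin \<open>b\<close> handles
      the later observations.\<close>
    let ?Z = "\<lambda>\<omega>. Z \<omega> * indicator (B b) (X (ennreal ?s) \<omega>)"
    have "(\<lambda>\<omega>. indicator (B b) (X (ennreal ?s) \<omega>) :: real) \<in> borel_measurable (F (ennreal ?s))"
      using measurable_compose[OF adapted borel_measurable_indicator[OF assms(2)]] .
    moreover have "Z \<in> borel_measurable (F (ennreal ?s))"
      using measurable_from_F[OF Z(1)] rb by (simp add: ennreal_leI)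
    ultimately have Zm: "?Z \<in> borel_measurable (F (ennreal ?s))" by simp
    have Zb: "\<bar>?Z \<omega>\<bar> \<le> 1" for \<omega> using Z(2) by (auto simp: indicator_def)
    have "b \<notin> J" using insert.hyps(2) by auto
    then have "(\<integral>\<omega>. Z \<omega> * (\<Prod>t\<in>insert b J. indicator (B t) (X (ennreal (s + (t - r))) \<omega>)) \<partial>P y)
        = (\<integral>\<omega>. ?Z \<omega> * (\<Prod>t\<in>J. indicator (B t) (X (ennreal (?s + (t - b))) \<omega>)) \<partial>P y)"
      using insert.hyps(1) by (simp add: algebra_simps)
    also have "\<dots> = (\<integral>\<omega>. ?Z \<omega> * u (X (ennreal ?s) \<omega>) \<partial>P y)"
      using s rb by (intro IH Zm Zb) auto
    also have "\<dots> = (\<integral>\<omega>. Z \<omega> * ?f (X (ennreal s + ennreal (b - r)) \<omega>) \<partial>P y)"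
      using s rb by (simp add: ennreal_plus[symmetric] mult.assoc del: ennreal_plus)
    also have "\<dots> = (\<integral>\<omega>. Z \<omega> * ?v (X (ennreal s) \<omega>) \<partial>P y)"
      by (rule markov_property[OF Z f])
    finally show ?thesis .
  qed
  ultimately show ?case
    using transition_measurable[OF f(1), of "ennreal (b - r)"] by (intro exI[of _ ?v]) auto
qed

section \<open>The path sigma-algebra and the Markov property for path events\<close>

text \<open>The sigma-algebra generated by \<open>X\<close> at finite times. The cylinders are taken
  as generators because they are stable under intersection.\<close>

definition path_sigma :: "'w measure" where
  "path_sigma = sigma (space M) {{\<omega> \<in> space M. \<forall>t\<in>J. X (ennreal t) \<omega> \<in> B t} | J B.
     finite J \<and> J \<subseteq> {0..} \<and> (\<forall>t. B t \<in> sets aug_borel)}"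

lemma space_path_sigma: "space path_sigma = space M"
  unfolding path_sigma_def by (rule space_measure_of) auto

lemma cylinder_in_M:
  assumes "finite J" "\<And>t. B t \<in> sets aug_borel"
  shows "{\<omega> \<in> space M. \<forall>t\<in>J. X (h t) \<omega> \<in> B t} \<in> sets M"
  using assms by (intro sets.sets_Collect_finite_All predE pred_X_in) auto

lemma pred_path_sigma_X_in:
  assumes "B \<in> sets aug_borel" "0 \<le> t"
  shows "Measurable.pred path_sigma (\<lambda>\<omega>. X (ennreal t) \<omega> \<in> B)"
proof -
  have "{\<omega> \<in> space M. \<forall>s\<in>{t}. X (ennreal s) \<omega> \<in> (\<lambda>_. B) s} \<in> sets path_sigma"
    unfolding path_sigma_def
    by (rule in_measure_of, blast, rule CollectI, rule exI[of _ "{t}"], rule exI[of _ "\<lambda>_. B"])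
       (use assms in auto)
  then show ?thesis by (simp add: pred_def space_path_sigma)
qed

text \<open>The shift is described only through its effect on \<open>X\<close>, so the target is
  \<open>path_sigma\<close> and not \<open>M\<close>: the preimage of a cylinder is the cylinder
  with times moved by \<open>h\<close>.\<close>

lemma measurable_shift: "\<theta> h \<in> M \<rightarrow>\<^sub>M path_sigma"
  unfolding path_sigma_def
proof (rule measurable_measure_of)
  fix A assume "A \<in> {{\<omega> \<in> space M. \<forall>t\<in>J. X (ennreal t) \<omega> \<in> B t} | J B.
     finite J \<and> J \<subseteq> {0..} \<and> (\<forall>t. B t \<in> sets aug_borel)}"
  then obtain J B where A: "A = {\<omega> \<in> space M. \<forall>t\<in>J. X (ennreal t) \<omega> \<in> B t}"
    "finite J" "\<And>t. B t \<in> sets aug_borel" by auto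
  have "\<theta> h -` A \<inter> space M = {\<omega> \<in> space M. \<forall>t\<in>J. X (ennreal t + h) \<omega> \<in> B t}"
    unfolding A by (auto simp: shift shift_space)
  with cylinder_in_M[OF A(2,3)] show "\<theta> h -` A \<inter> space M \<in> sets M" by simp
qed (auto simp: shift_space)

lemma sets_path_sigma_subset: "A \<in> sets path_sigma \<Longrightarrow> A \<in> sets M"
proof -
  have "sets path_sigma \<subseteq> sets M"
    unfolding path_sigma_def
    by (subst sets_measure_of) (auto intro!: sets.sigma_sets_subset cylinder_in_M)
  then show "A \<in> sets path_sigma \<Longrightarrow> A \<in> sets M" by auto
qed

lemma cylinder_markov:
  assumes J: "finite J" "J \<subseteq> {0..}" and B: "\<And>t. B t \<in> sets aug_borel"
  defines "A \<equiv> {\<omega> \<in> space M. \<forall>t\<in>J. X (ennreal t) \<omega> \<in> B t}"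
  shows "(\<lambda>y. emeasure (P y) A) \<in> borel_measurable aug_borel"
    and "0 \<le> s \<Longrightarrow> emeasure (P y) {\<omega> \<in> space M. \<theta> (ennreal s) \<omega> \<in> A}
          = (\<integral>\<^sup>+\<omega>. emeasure (P (X (ennreal s) \<omega>)) A \<partial>P y)"
proof -
  have r: "0 \<le> t" if "t \<in> J" for t using J that by auto
  from finite_dimensional_markov[where B=B, OF J(1) B r] obtain u :: "'a option \<Rightarrow> real" where u: "u \<in> borel_measurable aug_borel" "\<And>x. \<bar>u x\<bar> \<le> 1"
    and U: "\<And>y s Z. 0 \<le> s \<Longrightarrow> Z \<in> borel_measurable (F (ennreal s)) \<Longrightarrow> (\<And>\<omega>. \<bar>Z \<omega>\<bar> \<le> 1) \<Longrightarrow>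
      (\<integral>\<omega>. Z \<omega> * (\<Prod>t\<in>J. indicator (B t) (X (ennreal (s + (t - 0))) \<omega>)) \<partial>P y)
        = (\<integral>\<omega>. Z \<omega> * u (X (ennreal s) \<omega>) \<partial>P y)"
    by blast
  have meas: "measure (P y) {\<omega> \<in> space M. \<forall>t\<in>J. X (ennreal (s + t)) \<omega> \<in> B t} = (\<integral>\<omega>. u (X (ennreal s) \<omega>) \<partial>P y)"
    if "0 \<le> s" for s y
  proof -
    let ?A = "{\<omega> \<in> space M. \<forall>t\<in>J. X (ennreal (s + t)) \<omega> \<in> B t}"
    have "?A \<in> sets (P y)" using cylinder_in_M[OF J(1) B] by (simp add: sets_P)
    then have "measure (P y) ?A = (\<integral>\<omega>. indicator ?A \<omega> \<partial>P y)"
      using sets.sets_into_space[of ?A "P y"] by (simp add: Int_absorb2)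
    \<comment> \<open>The product of indicators is the indicator of the cylinder; weight
      \<open>1\<close> and origin \<open>0\<close> fit it to the finite-dimensional
      statement.\<close>
    also have "\<dots> = (\<integral>\<omega>. 1 * (\<Prod>t\<in>J. indicator (B t) (X (ennreal (s + (t - 0))) \<omega>)) \<partial>P y)"
      using J(1) by (intro Bochner_Integration.integral_cong refl)
        (auto simp: indicator_def space_P prod_zero_iff)
    also have "\<dots> = (\<integral>\<omega>. 1 * u (X (ennreal s) \<omega>) \<partial>P y)" by (rule U[OF that]) auto
    finally show ?thesis by simp
  qed
  \<comment> \<open>At \<open>s = 0\<close> the process is almost surely at \<open>y\<close>, which
    identifies \<open>u y\<close> with the probability of the cylinder.\<close>
  have uA: "u y = measure (P y) A" for y
  proof -
    interpret prob_space "P y" by (rule prob_space_P)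
    have "measure (P y) A = (\<integral>\<omega>. u (X 0 \<omega>) \<partial>P y)"
      using meas[of 0 y] by (simp add: A_def)
    also have "\<dots> = (\<integral>\<omega>. u y \<partial>P y)"
      using normal[of y] measurable_M_imp_P[OF measurable_compose[OF measurable_X u(1)]]
      by (intro integral_cong_AE) auto
    finally show ?thesis by (simp add: prob_space)
  qed
  have eA: "emeasure (P y) A = ennreal (u y)" for y
  proof -
    interpret prob_space "P y" by (rule prob_space_P)
    show ?thesis by (simp add: uA emeasure_eq_measure)
  qed
  show "(\<lambda>y. emeasure (P y) A) \<in> borel_measurable aug_borel"
    unfolding eA using u(1) by simp
  show "emeasure (P y) {\<omega> \<in> space M. \<theta> (ennreal s) \<omega> \<in> A}
          = (\<integral>\<^sup>+\<omega>. emeasure (P (X (ennreal s) \<omega>)) A \<partial>P y)" if s: "0 \<le> s"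
  proof -
    interpret prob_space "P y" by (rule prob_space_P)
    have "{\<omega> \<in> space M. \<theta> (ennreal s) \<omega> \<in> A} = {\<omega> \<in> space M. \<forall>t\<in>J. X (ennreal (s + t)) \<omega> \<in> B t}"
      using s r by (auto simp: A_def shift shift_space add.commute)
    then have "emeasure (P y) {\<omega> \<in> space M. \<theta> (ennreal s) \<omega> \<in> A} = ennreal (\<integral>\<omega>. u (X (ennreal s) \<omega>) \<partial>P y)"
      using meas[OF s] by (simp add: emeasure_eq_measure)
    also have "\<dots> = (\<integral>\<^sup>+\<omega>. ennreal (u (X (ennreal s) \<omega>)) \<partial>P y)"
    proof (rule nn_integral_eq_integral[symmetric])
      show "integrable (P y) (\<lambda>\<omega>. u (X (ennreal s) \<omega>))"
        using u(2) measurable_M_imp_P[OF measurable_compose[OF measurable_X u(1)]]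
        by (intro integrable_const_bound[where B=1]) auto
    qed (simp add: uA)
    finally show ?thesis by (simp add: eA)
  qed
qed

text \<open>A Dynkin argument from the cylinders. Measurability in the starting point is carried
  along because the complement and union steps integrate these probabilities.\<close>

lemma path_markov:
  assumes "A \<in> sets path_sigma"
  shows "(\<lambda>y. emeasure (P y) A) \<in> borel_measurable aug_borel \<and>
    (\<forall>s y. 0 \<le> s \<longrightarrow> emeasure (P y) {\<omega> \<in> space M. \<theta> (ennreal s) \<omega> \<in> A}
          = (\<integral>\<^sup>+\<omega>. emeasure (P (X (ennreal s) \<omega>)) A \<partial>P y))"
proof -
  let ?G = "{{\<omega> \<in> space M. \<forall>t\<in>J. X (ennreal t) \<omega> \<in> B t} | J B.
     finite J \<and> J \<subseteq> {0..} \<and> (\<forall>t. B t \<in> sets aug_borel)}"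
  have G: "?G \<subseteq> Pow (space M)" by auto
  have sets_eq: "sets path_sigma = sigma_sets (space M) ?G"
    unfolding path_sigma_def by (rule sets_measure_of[OF G])
  have "Int_stable ?G"
  proof (rule Int_stableI)
    fix A A' assume "A \<in> ?G" "A' \<in> ?G"
    then obtain J B J' B' where
      A: "A = {\<omega> \<in> space M. \<forall>t\<in>J. X (ennreal t) \<omega> \<in> B t}" "finite J" "J \<subseteq> {0..}" "\<And>t. B t \<in> sets aug_borel" and
      A': "A' = {\<omega> \<in> space M. \<forall>t\<in>J'. X (ennreal t) \<omega> \<in> B' t}" "finite J'" "J' \<subseteq> {0..}" "\<And>t. B' t \<in> sets aug_borel"
      by auto
    \<comment> \<open>\<open>UNIV\<close> is the default at times observed by only one of the two
      cylinders.\<close>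
    let ?B = "\<lambda>t. (if t \<in> J then B t else UNIV) \<inter> (if t \<in> J' then B' t else UNIV)"
    have "A \<inter> A' = {\<omega> \<in> space M. \<forall>t\<in>J \<union> J'. X (ennreal t) \<omega> \<in> ?B t}"
      unfolding A(1) A'(1) by auto
    moreover have "?B t \<in> sets aug_borel" for t
      using A(4) A'(4) sets.top[of "aug_borel :: 'a option measure"] by auto
    ultimately show "A \<inter> A' \<in> ?G"
      using A(2,3) A'(2,3) by (intro CollectI exI[of _ "J \<union> J'"] exI[of _ ?B]) auto
  qed
  from this G assms[unfolded sets_eq] show ?thesis
  proof (induct rule: sigma_sets_induct_disjoint)
    case (basic A)
    then obtain J B where A: "A = {\<omega> \<in> space M. \<forall>t\<in>J. X (ennreal t) \<omega> \<in> B t}"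
      "finite J" "J \<subseteq> {0..}" "\<And>t. B t \<in> sets aug_borel" by auto
    show ?case unfolding A(1) using cylinder_markov[where B=B, OF A(2-4)] by blast
  next
    case empty
    show ?case by simp
  next
    case (compl A)
    then have A: "A \<in> sets path_sigma" by (simp add: sets_eq)
    have AM: "A \<in> sets (P y)" for y using sets_path_sigma_subset[OF A] by (simp add: sets_P)
    have c: "emeasure (P y) (space M - A) = 1 - emeasure (P y) A" for y
    proof -
      interpret prob_space "P y" by (rule prob_space_P)
      show ?thesis using emeasure_compl[OF AM, of y] emeasure_space_1 by (simp add: space_P)
    qed
    have m: "(\<lambda>y. emeasure (P y) A) \<in> borel_measurable aug_borel" using compl by blast
    have "emeasure (P y) {\<omega> \<in> space M. \<theta> (ennreal s) \<omega> \<in> space M - A}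
          = (\<integral>\<^sup>+\<omega>. emeasure (P (X (ennreal s) \<omega>)) (space M - A) \<partial>P y)" if "0 \<le> s" for s y
    proof -
      interpret prob_space "P y" by (rule prob_space_P)
      let ?E = "{\<omega> \<in> space M. \<theta> (ennreal s) \<omega> \<in> A}"
      have E: "?E \<in> sets (P y)"
        using measurable_sets[OF measurable_shift A, of "ennreal s"] by (simp add: sets_P vimage_def Int_def conj_commute)
      have E_eq: "emeasure (P y) ?E = (\<integral>\<^sup>+\<omega>. emeasure (P (X (ennreal s) \<omega>)) A \<partial>P y)"
        using compl that by blast
      have "{\<omega> \<in> space M. \<theta> (ennreal s) \<omega> \<in> space M - A} = space (P y) - ?E"
        by (auto simp: space_P shift_space)
      then have "emeasure (P y) {\<omega> \<in> space M. \<theta> (ennreal s) \<omega> \<in> space M - A} = 1 - emeasure (P y) ?E"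
        using emeasure_compl[OF E] emeasure_space_1 by simp
      \<comment> \<open>With \<open>1\<close> written as an integral the difference passes under the
        integral sign; in \<open>ennreal\<close> this is sound since the subtracted integral is
        finite and its integrand is at most \<open>1\<close>.\<close>
      also have "\<dots> = (\<integral>\<^sup>+\<omega>. 1 \<partial>P y) - (\<integral>\<^sup>+\<omega>. emeasure (P (X (ennreal s) \<omega>)) A \<partial>P y)"
        by (simp add: E_eq emeasure_space_1)
      also have "\<dots> = (\<integral>\<^sup>+\<omega>. 1 - emeasure (P (X (ennreal s) \<omega>)) A \<partial>P y)"
      proof (rule nn_integral_diff[symmetric])
        show "(\<lambda>\<omega>. emeasure (P (X (ennreal s) \<omega>)) A) \<in> borel_measurable (P y)"
          by (rule measurable_M_imp_P[OF measurable_compose[OF measurable_X m]])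
        show "(\<integral>\<^sup>+\<omega>. emeasure (P (X (ennreal s) \<omega>)) A \<partial>P y) \<noteq> \<infinity>"
          using E_eq[symmetric] by simp
        show "AE \<omega> in P y. emeasure (P (X (ennreal s) \<omega>)) A \<le> 1"
          using prob_space_P by (auto intro!: AE_I2 subprob_space.subprob_emeasure_le_1 prob_space_imp_subprob_space)
      qed simp
      finally show ?thesis by (simp add: c)
    qed
    then show ?case using m by (simp add: c)
  next
    case (union A)
    then have A: "A i \<in> sets path_sigma" for i by (auto simp: sets_eq)
    have AM: "A i \<in> sets (P y)" for i y using sets_path_sigma_subset[OF A] by (simp add: sets_P)
    have m: "(\<lambda>y. emeasure (P y) (A i)) \<in> borel_measurable aug_borel" for i using union by blast
    have u: "emeasure (P y) (\<Union>i. A i) = (\<Sum>i. emeasure (P y) (A i))" for y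
      using AM union by (intro suminf_emeasure[symmetric]) auto
    have "emeasure (P y) {\<omega> \<in> space M. \<theta> (ennreal s) \<omega> \<in> (\<Union>i. A i)}
          = (\<integral>\<^sup>+\<omega>. emeasure (P (X (ennreal s) \<omega>)) (\<Union>i. A i) \<partial>P y)" if "0 \<le> s" for s y
    proof -
      let ?E = "\<lambda>i. {\<omega> \<in> space M. \<theta> (ennreal s) \<omega> \<in> A i}"
      have E: "?E i \<in> sets (P y)" for i
        using measurable_sets[OF measurable_shift A, of "ennreal s"] by (simp add: sets_P vimage_def Int_def conj_commute)
      have "emeasure (P y) {\<omega> \<in> space M. \<theta> (ennreal s) \<omega> \<in> (\<Union>i. A i)} = emeasure (P y) (\<Union>i. ?E i)"
        by (auto intro!: arg_cong[where f="emeasure _"])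
      also have "\<dots> = (\<Sum>i. emeasure (P y) (?E i))"
        using E union(1) by (intro suminf_emeasure[symmetric]) (auto simp: disjoint_family_on_def)
      also have "\<dots> = (\<Sum>i. \<integral>\<^sup>+\<omega>. emeasure (P (X (ennreal s) \<omega>)) (A i) \<partial>P y)"
        using union that by simp
      also have "\<dots> = (\<integral>\<^sup>+\<omega>. (\<Sum>i. emeasure (P (X (ennreal s) \<omega>)) (A i)) \<partial>P y)"
        by (intro nn_integral_suminf[symmetric] measurable_M_imp_P[OF measurable_compose[OF measurable_X m]])
      finally show ?thesis by (simp add: u)
    qed
    then show ?case using m by (simp add: u)
  qed
qed


lemma path_markov_measure:
  assumes A: "A \<in> sets path_sigma" and s: "0 \<le> s"
  shows "measure (P y) {\<omega> \<in> space M. \<theta> (ennreal s) \<omega> \<in> A}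
          = (\<integral>\<omega>. measure (P (X (ennreal s) \<omega>)) A \<partial>P y)"
proof -
  interpret prob_space "P y" by (rule prob_space_P)
  have e: "emeasure (P x) A = ennreal (measure (P x) A)" for x
    by (rule finite_measure.emeasure_eq_measure[OF prob_space.finite_measure[OF prob_space_P]])
  have m: "(\<lambda>x. measure (P x) A) \<in> borel_measurable aug_borel"
    unfolding measure_def using path_markov[OF A] by (intro borel_measurable_enn2real) blast
  have i: "integrable (P y) (\<lambda>\<omega>. measure (P (X (ennreal s) \<omega>)) A)"
    using measurable_M_imp_P[OF measurable_compose[OF measurable_X m]] prob_space_P
    by (intro integrable_const_bound[where B=1]) (auto intro!: AE_I2 prob_space.prob_le_1)
  have "ennreal (measure (P y) {\<omega> \<in> space M. \<theta> (ennreal s) \<omega> \<in> A})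
      = (\<integral>\<^sup>+\<omega>. emeasure (P (X (ennreal s) \<omega>)) A \<partial>P y)"
    unfolding emeasure_eq_measure[symmetric] using path_markov[OF A] s by blast
  also have "\<dots> = ennreal (\<integral>\<omega>. measure (P (X (ennreal s) \<omega>)) A \<partial>P y)"
    unfolding e by (rule nn_integral_eq_integral[OF i]) simp
  finally show ?thesis
    by (subst (asm) ennreal_inj) (auto intro!: integral_nonneg_AE)
qed

text \<open>The Dirac law at \<open>y\<close> is an initial law, and the exceptional set that
  belongs to it is null under \<open>P y\<close>.\<close>

lemma AE_almost_surely:
  assumes "almost_surely M P Q"
  shows "AE \<omega> in P y. Q \<omega>"
proof -
  have "prob_space (return aug_borel y)" by (rule prob_space_return) simp
  then have "return aug_borel y \<in> initial_laws" by (simp add: initial_laws_def)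
  then obtain N where N: "N \<in> sets M" "AE x in return aug_borel y. emeasure (P x) N = 0"
    "{\<omega> \<in> space M. \<not> Q \<omega>} \<subseteq> N"
    using assms unfolding almost_surely_def law_null_sets_def by blast
  from N(2) obtain B where B: "{x \<in> space (return aug_borel y). emeasure (P x) N \<noteq> 0} \<subseteq> B"
    "emeasure (return aug_borel y) B = 0" "B \<in> sets (return aug_borel y)"
    by (rule AE_E)
  then have "y \<notin> B" by auto
  then have "emeasure (P y) N = 0" using B(1) by auto
  with N(1,3) show ?thesis
    by (intro AE_I[where N=N]) (auto simp: sets_P space_P)
qed

end

section \<open>Shrinking neighbourhoods of \<open>D\<close> and limits from the right\<close>

lemma limitin_aug_top_SomeD:
  assumes "limitin aug_top f (Some y) G" "open U" "y \<in> U"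
  shows "\<forall>\<^sub>F s in G. f s \<in> Some ` U"
  using assms openin_aug_top_Some_image[of U] unfolding limitin_def by blast

text \<open>For closed nonempty \<open>D\<close> these open sets shrink to \<open>D\<close>. Since
  \<open>infdist y {} = 0\<close>, for empty \<open>D\<close> each of them is the whole space, hence
  the assumption \<open>D \<noteq> {}\<close> below.\<close>

definition infdist_nbhd :: "'a::euclidean_space set \<Rightarrow> nat \<Rightarrow> 'a set" where
  "infdist_nbhd D n = {y. infdist y D < inverse (real (Suc n))}"

lemma open_infdist_nbhd: "open (infdist_nbhd D n)"
  unfolding infdist_nbhd_def by (intro open_Collect_less continuous_intros)

lemma infdist_nbhd_antimono: "m \<le> n \<Longrightarrow> infdist_nbhd D n \<subseteq> infdist_nbhd D m"
  unfolding infdist_nbhd_def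
  by (intro Collect_mono impI) (erule less_le_trans, auto intro!: le_imp_inverse_le)

lemma subset_infdist_nbhd: "D \<subseteq> infdist_nbhd D n"
  by (auto simp: infdist_nbhd_def)

lemma eventually_at_right_ennrealD:
  assumes "eventually Q (at_right (ennreal t))" "0 \<le> t"
  shows "\<exists>b>t. \<forall>u. t < u \<and> u < b \<longrightarrow> Q (ennreal u)"
proof -
  obtain b where b: "ennreal t < b" "\<And>u. ennreal t < u \<Longrightarrow> u < b \<Longrightarrow> Q u"
    using eventually_at_right[THEN iffD1, OF _ assms(1), of top] by (auto simp: ennreal_less_top)
  \<comment> \<open>\<open>b\<close> may be infinite; any \<open>c\<close> strictly below it is a
    real number.\<close>
  obtain c where c: "ennreal t < c" "c < b" using dense[OF b(1)] by blast
  then obtain c' where c': "c = ennreal c'" "0 \<le> c'" by (cases c) (use c in auto)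
  have "t < c'" using c(1) assms(2) by (simp add: c' ennreal_less_iff)
  moreover have "Q (ennreal u)" if "t < u" "u < c'" for u
  proof (rule b(2))
    show "ennreal t < ennreal u" using that assms(2) by (simp add: ennreal_less_iff)
    have "ennreal u < ennreal c'" using that assms(2) by (simp add: ennreal_less_iff)
    then show "ennreal u < b" using c(2) c' by simp
  qed
  ultimately show ?thesis by blast
qed

section \<open>Visits to \<open>D\<close> as a path event, and its continuity in the starting
  point\<close>

context standard_process
begin

text \<open>Survival up to a later rational time is required because quasi-left-continuity gives no
  control over a path that approaches \<open>D\<close> as it dies.\<close>

definition visits :: "'a set \<Rightarrow> real \<Rightarrow> 'w set" where
  "visits D r = {\<omega> \<in> space M. \<exists>s s' :: rat. (0 \<le> s \<and> s < s' \<and> of_rat s' < r) \<and>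
     X (ennreal (of_rat s')) \<omega> \<noteq> None \<and>
     (\<forall>n. \<exists>q. (0 \<le> q \<and> q \<le> s) \<and> X (ennreal (of_rat q)) \<omega> \<in> Some ` infdist_nbhd D n)}"

text \<open>All quantifiers range over rationals or naturals, so the event is a countable
  combination of events at single nonnegative times.\<close>

lemma visits_in_path_sigma: "visits D r \<in> sets path_sigma"
proof -
  have a: "Measurable.pred path_sigma (\<lambda>\<omega>. X (ennreal (of_rat s)) \<omega> \<noteq> None)" if "0 \<le> s" for s
  proof -
    have "Measurable.pred path_sigma (\<lambda>\<omega>. X (ennreal (of_rat s)) \<omega> \<in> Some ` UNIV)"
      using that by (intro pred_path_sigma_X_in Some_image_in_sets_aug_borel) auto
    moreover have "X (ennreal (of_rat s)) \<omega> \<in> Some ` UNIV \<longleftrightarrow> X (ennreal (of_rat s)) \<omega> \<noteq> None" for \<omega>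
      by (cases "X (ennreal (of_rat s)) \<omega>") auto
    ultimately show ?thesis by (rule subst[of _ _ "Measurable.pred path_sigma", OF ext, rotated])
  qed
  have b: "Measurable.pred path_sigma (\<lambda>\<omega>. X (ennreal (of_rat q)) \<omega> \<in> Some ` infdist_nbhd D n)"
    if "0 \<le> q" for q n
    using that by (intro pred_path_sigma_X_in Some_image_in_sets_aug_borel open_infdist_nbhd) auto
  have c: "Measurable.pred path_sigma (\<lambda>\<omega>. \<forall>n. \<exists>q. (0 \<le> q \<and> q \<le> s) \<and>
     X (ennreal (of_rat q)) \<omega> \<in> Some ` infdist_nbhd D n)" for s
    by (rule pred_intros_countable(1), rule pred_intros_countable(2), rule pred_intros_conj1', rule b) simp
  have "Measurable.pred path_sigma (\<lambda>\<omega>. \<exists>s s' :: rat. (0 \<le> s \<and> s < s' \<and> of_rat s' < r) \<and>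
     X (ennreal (of_rat s')) \<omega> \<noteq> None \<and>
     (\<forall>n. \<exists>q. (0 \<le> q \<and> q \<le> s) \<and> X (ennreal (of_rat q)) \<omega> \<in> Some ` infdist_nbhd D n))"
    by (rule pred_intros_countable(2), rule pred_intros_countable(2), rule pred_intros_conj1',
        rule pred_intros_logic(3), rule a) (simp_all only: c, simp)
  then show ?thesis unfolding visits_def pred_def space_path_sigma .
qed

text \<open>A dead path stays dead, so the visiting probability vanishes at the cemetery. This
  agrees with the zero extension of functions in \<open>strong_feller\<close>.\<close>

lemma visits_None: "measure (P None) (visits D r) = 0"
proof -
  have "AE \<omega> in P None. \<omega> \<notin> visits D r"
    using normal[of None] AE_space
  proof eventually_elim
    case (elim \<omega>)
    then have "X t \<omega> = None" for t
      using absorbing[of \<omega> 0 t] by (simp add: space_P)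
    then show ?case by (simp add: visits_def)
  qed
  then have "emeasure (P None) {\<omega> \<in> space (P None). \<omega> \<in> visits D r} = 0"
    by (subst (asm) AE_iff_measurable[OF _ refl])
       (use sets_path_sigma_subset[OF visits_in_path_sigma] in
         \<open>auto simp: sets_P space_P Int_def[symmetric] intro!: sets.Int\<close>)
  moreover have "{\<omega> \<in> space (P None). \<omega> \<in> visits D r} = visits D r"
    by (auto simp: visits_def space_P)
  ultimately show ?thesis by (simp add: measure_def)
qed

text \<open>By the Markov property at \<delta> the probability is the expectation of the bounded
  Borel function \<open>?f\<close> at \<open>X (ennreal \<delta>)\<close>, to which the strong
  Feller property applies because \<delta> is positive.\<close>

lemma continuous_on_visits:
  assumes "strong_feller X P" "0 < \<delta>"
  shows "continuous_on UNIV (\<lambda>y. measure (P (Some y)) {\<omega> \<in> space M. \<theta> (ennreal \<delta>) \<omega> \<in> visits D r})"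
proof -
  let ?A = "visits D r"
  let ?f = "\<lambda>y. measure (P (Some y)) ?A"
  have m: "(\<lambda>x. measure (P x) ?A) \<in> borel_measurable aug_borel"
    unfolding measure_def using path_markov[OF visits_in_path_sigma]
    by (intro borel_measurable_enn2real) blast
  have "?f \<in> borel_measurable borel"
    by (rule measurable_compose[OF measurable_Some_aug_borel m])
  moreover have "bounded (range ?f)"
    using prob_space_P by (auto simp: bounded_iff intro!: exI[of _ 1] prob_space.prob_le_1)
  ultimately have "continuous_on UNIV
      (\<lambda>x. \<integral>\<omega>. (case X (ennreal \<delta>) \<omega> of None \<Rightarrow> 0 | Some y \<Rightarrow> ?f y) \<partial>P (Some x))"
    using assms unfolding strong_feller_def by (auto simp: ennreal_less_top)
  moreover have "(case x of None \<Rightarrow> 0 | Some y \<Rightarrow> ?f y) = measure (P x) ?A" for x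
    by (cases x) (auto simp: visits_None)
  ultimately show ?thesis
    using path_markov_measure[OF visits_in_path_sigma, of \<delta>] assms(2) by simp
qed

lemma shift_visits_iff:
  assumes "\<omega> \<in> space M" "0 \<le> \<delta>"
  shows "\<theta> (ennreal \<delta>) \<omega> \<in> visits D r \<longleftrightarrow>
    (\<exists>s s' :: rat. (0 \<le> s \<and> s < s' \<and> of_rat s' < r) \<and>
     X (ennreal (\<delta> + of_rat s')) \<omega> \<noteq> None \<and>
     (\<forall>n. \<exists>q. (0 \<le> q \<and> q \<le> s) \<and> X (ennreal (\<delta> + of_rat q)) \<omega> \<in> Some ` infdist_nbhd D n))"
proof -
  have "X (ennreal (of_rat q)) (\<theta> (ennreal \<delta>) \<omega>) = X (ennreal (\<delta> + of_rat q)) \<omega>" if "0 \<le> q" for q :: rat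
    using assms that by (simp add: shift add.commute)
  then show ?thesis
    using shift_space[OF assms(1), of "ennreal \<delta>"] unfolding visits_def by (simp cong: conj_cong)
qed

section \<open>Rational entry times and the visit at their supremum\<close>

text \<open>For a right-continuous path this is the first entry after \<delta> into the open
  neighbourhood; countably many times suffice. They are offset by \<delta> to match the observations
  in the shifted event \<open>visits\<close>.\<close>

definition rat_entry_time :: "'a set \<Rightarrow> real \<Rightarrow> nat \<Rightarrow> 'w \<Rightarrow> ennreal" where
  "rat_entry_time D \<delta> n \<omega> =
     Inf {ennreal (\<delta> + of_rat q) | q. 0 \<le> q \<and> X (ennreal (\<delta> + of_rat q)) \<omega> \<in> Some ` infdist_nbhd D n}"

lemma incseq_rat_entry_time: "incseq (\<lambda>n. rat_entry_time D \<delta> n \<omega>)"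
  unfolding rat_entry_time_def
  by (intro monoI Inf_superset_mono) (use infdist_nbhd_antimono in blast)

text \<open>The infimum may be unattained, so whether it is at most \<open>t\<close> is decided only
  by looking slightly beyond \<open>t\<close>. The event thus lies in \<open>F s\<close> for every
  \<open>s > t\<close>, and right-continuity of the filtration brings it into
  \<open>F t\<close>.\<close>

lemma stopping_time_rat_entry_time: "stopping_time F (rat_entry_time D \<delta> n)"
proof
  fix t :: ennreal
  let ?Q = "\<lambda>q \<omega>. X (ennreal (\<delta> + of_rat q)) \<omega> \<in> Some ` infdist_nbhd D n"
  show "Measurable.pred (F t) (\<lambda>\<omega>. rat_entry_time D \<delta> n \<omega> \<le> t)"
  proof (cases "t = \<infinity>")
    case False
    have "{\<omega> \<in> space M. rat_entry_time D \<delta> n \<omega> \<le> t} \<in> sets (F s)" if "t < s" for s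
    proof -
      \<comment> \<open>The restriction \<open>ennreal (of_rat r) < s\<close> ensures that only
        values of \<open>X\<close> before \<open>s\<close> are consulted.\<close>
      have eq: "rat_entry_time D \<delta> n \<omega> \<le> t \<longleftrightarrow>
        (\<forall>r::rat. t < ennreal (of_rat r) \<and> ennreal (of_rat r) < s \<longrightarrow>
          (\<exists>q. (0 \<le> q \<and> ennreal (\<delta> + of_rat q) < ennreal (of_rat r)) \<and> ?Q q \<omega>))" (is "?l \<longleftrightarrow> ?r") for \<omega>
      proof
        assume ?l
        show ?r
        proof (intro allI impI)
          fix r :: rat assume "t < ennreal (of_rat r) \<and> ennreal (of_rat r) < s"
          with \<open>?l\<close> have "rat_entry_time D \<delta> n \<omega> < ennreal (of_rat r)" by auto
          then show "\<exists>q. (0 \<le> q \<and> ennreal (\<delta> + of_rat q) < ennreal (of_rat r)) \<and> ?Q q \<omega>"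
            unfolding rat_entry_time_def Inf_less_iff by blast
        qed
      next
        assume r: ?r
        show ?l
        proof (rule ccontr)
          assume "\<not> ?l"
          with that have "t < min s (rat_entry_time D \<delta> n \<omega>)" by simp
          from ennreal_rat_dense[OF this] obtain r :: rat
            where "t < ennreal (of_rat r)" "ennreal (of_rat r) < min s (rat_entry_time D \<delta> n \<omega>)" by auto
          moreover from this r obtain q where "0 \<le> q" "ennreal (\<delta> + of_rat q) < ennreal (of_rat r)" "?Q q \<omega>"
            by auto
          moreover from this have "rat_entry_time D \<delta> n \<omega> \<le> ennreal (\<delta> + of_rat q)"
            unfolding rat_entry_time_def by (intro Inf_lower) blast
          ultimately show False by auto
        qed
      qed
      have Q: "Measurable.pred (F s) (?Q q)" if "ennreal (\<delta> + of_rat q) \<le> s" for q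
        using pred_sets2[OF Some_image_in_sets_aug_borel[OF open_infdist_nbhd] measurable_from_F[OF adapted that]] .
      have "Measurable.pred (F s) (\<lambda>\<omega>. rat_entry_time D \<delta> n \<omega> \<le> t)"
        unfolding eq by (intro pred_intros_countable pred_intros_imp' pred_intros_conj1' Q) auto
      then show ?thesis by (simp add: pred_def space_F)
    qed
    then show ?thesis
      using right_continuous_F[of t] False by (simp add: pred_def space_F less_top)
  qed simp
qed

text \<open>A statement about a single path: the almost sure properties enter as hypotheses. The
  positions at the rational entry times come arbitrarily close to \<open>D\<close> and converge to
  the position at \<open>T\<close>, which closedness puts into \<open>D\<close>.\<close>

lemma visits_imp_entry_time_less:
  assumes \<omega>: "\<omega> \<in> space M" and D: "closed D" "D \<noteq> {}" and \<delta>: "0 \<le> \<delta>"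
    and right: "\<And>t. t < \<infinity> \<Longrightarrow> limitin aug_top (\<lambda>s. X s \<omega>) (X t \<omega>) (at_right t)"
    and left: "(SUP n. rat_entry_time D \<delta> n \<omega>) < lifetime X \<omega> \<Longrightarrow>
      limitin aug_top (\<lambda>n. X (rat_entry_time D \<delta> n \<omega>) \<omega>) (X (SUP n. rat_entry_time D \<delta> n \<omega>) \<omega>) sequentially"
    and visit: "\<theta> (ennreal \<delta>) \<omega> \<in> visits D r"
  shows "entry_time X D \<omega> < ennreal (\<delta> + r)"
proof -
  let ?T = "\<lambda>n. rat_entry_time D \<delta> n \<omega>"
  define T where "T = (SUP n. ?T n)"
  from visit obtain s s' :: rat where s: "0 \<le> s" "s < s'" "of_rat s' < r"
    and alive: "X (ennreal (\<delta> + of_rat s')) \<omega> \<noteq> None"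
    and near: "\<And>n. \<exists>q. (0 \<le> q \<and> q \<le> s) \<and> X (ennreal (\<delta> + of_rat q)) \<omega> \<in> Some ` infdist_nbhd D n"
    unfolding shift_visits_iff[OF \<omega> \<delta>] by blast
  have s_less: "(of_rat s :: real) < of_rat s'" "(0::real) \<le> of_rat s" using s by (auto simp: of_rat_less)
  have T_le: "?T n \<le> ennreal (\<delta> + of_rat s)" for n
  proof -
    obtain q where "0 \<le> q" "q \<le> s" "X (ennreal (\<delta> + of_rat q)) \<omega> \<in> Some ` infdist_nbhd D n"
      using near by blast
    then have "?T n \<le> ennreal (\<delta> + of_rat q)"
      unfolding rat_entry_time_def by (intro Inf_lower) blast
    also have "\<dots> \<le> ennreal (\<delta> + of_rat s)"
      using \<open>q \<le> s\<close> by (intro ennreal_leI) (simp add: of_rat_less_eq)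
    finally show ?thesis .
  qed
  then have T: "T \<le> ennreal (\<delta> + of_rat s)" unfolding T_def by (rule SUP_least)
  \<comment> \<open>Survival at the strictly later \<open>s'\<close> gives the strict inequality
    with the lifetime that quasi-left-continuity asks for.\<close>
  have "ennreal (\<delta> + of_rat s) < ennreal (\<delta> + of_rat s')"
    using s_less \<delta> by (simp add: ennreal_less_iff del: ennreal_plus)
  also have "\<dots> \<le> lifetime X \<omega>"
    unfolding lifetime_def
  proof (rule Inf_greatest)
    fix t assume "t \<in> {t. X t \<omega> = None}"
    then show "ennreal (\<delta> + of_rat s') \<le> t"
      using absorbing[OF \<omega>, of t "ennreal (\<delta> + of_rat s')"] alive by (cases "t \<le> ennreal (\<delta> + of_rat s')") auto
  qed
  finally have life: "t < lifetime X \<omega>" if "t \<le> ennreal (\<delta> + of_rat s)" for t using that by simp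
  have some: "\<exists>y. X t \<omega> = Some y" if "t \<le> ennreal (\<delta> + of_rat s)" for t
  proof (rule ccontr)
    assume "\<not> ?thesis"
    then have "lifetime X \<omega> \<le> t" unfolding lifetime_def by (intro Inf_lower) auto
    with life[OF that] show False by simp
  qed
  from some[OF T] obtain y where y: "X T \<omega> = Some y" by blast
  \<comment> \<open>If the path were farther away at \<open>?T n\<close>, right-continuity would
    keep it away for a while, but entries occur at times arbitrarily close to the infimum. The bound
    is not strict, since the infimum may be reached on the boundary of the neighbourhood.\<close>
  have near_T: "infdist v D \<le> inverse (real (Suc n))" if v: "X (?T n) \<omega> = Some v" for n v
  proof (rule ccontr)
    assume *: "\<not> ?thesis"
    let ?U = "{v. inverse (real (Suc n)) < infdist v D}"
    have fin: "?T n < \<infinity>" using T_le[of n] by (simp add: le_less_trans)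
    have "open ?U" by (intro open_Collect_less continuous_intros)
    with right[OF fin] v * have "\<forall>\<^sub>F s in at_right (?T n). X s \<omega> \<in> Some ` ?U"
      by (intro limitin_aug_top_SomeD[of _ v]) auto
    then obtain b where b: "?T n < b" "\<And>t. ?T n < t \<Longrightarrow> t < b \<Longrightarrow> X t \<omega> \<in> Some ` ?U"
      using eventually_at_right[OF fin] by auto
    from b(1) obtain q where q: "0 \<le> q" "X (ennreal (\<delta> + of_rat q)) \<omega> \<in> Some ` infdist_nbhd D n"
      "ennreal (\<delta> + of_rat q) < b"
      unfolding rat_entry_time_def Inf_less_iff by blast
    have "?T n \<le> ennreal (\<delta> + of_rat q)"
      unfolding rat_entry_time_def using q by (intro Inf_lower) blast
    moreover have "X (?T n) \<omega> \<notin> Some ` infdist_nbhd D n"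
      using v * by (auto simp: infdist_nbhd_def)
    ultimately have "?T n < ennreal (\<delta> + of_rat q)"
      using q(2) by (cases "?T n = ennreal (\<delta> + of_rat q)") auto
    from b(2)[OF this q(3)] q(2) show False by (auto simp: infdist_nbhd_def)
  qed
  have "y \<in> D"
  proof (rule ccontr)
    assume "y \<notin> D"
    then have pos: "0 < infdist y D"
      using in_closed_iff_infdist_zero[OF D] infdist_nonneg[of y D] by (auto simp: less_le)
    \<comment> \<open>Half the distance separates \<open>y\<close> from \<open>D\<close>: the
      positions near \<open>y\<close> stay beyond it, while the bound from \<open>near_T\<close>
      eventually falls below it.\<close>
    let ?U = "{v. infdist y D / 2 < infdist v D}"
    have "limitin aug_top (\<lambda>n. X (?T n) \<omega>) (Some y) sequentially"
      using left life[OF T] unfolding T_def[symmetric] y by simp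
    moreover have "open ?U" by (intro open_Collect_less continuous_intros)
    ultimately have "\<forall>\<^sub>F n in sequentially. X (?T n) \<omega> \<in> Some ` ?U"
      using pos by (intro limitin_aug_top_SomeD[of _ y]) auto
    moreover have "\<forall>\<^sub>F n in sequentially. inverse (real (Suc n)) < infdist y D / 2"
      using pos by (intro order_tendstoD[OF LIMSEQ_inverse_real_of_nat]) simp
    ultimately have "\<forall>\<^sub>F n in sequentially. False"
    proof eventually_elim
      case (elim n)
      then obtain v where "X (?T n) \<omega> = Some v" "infdist y D / 2 < infdist v D" by auto
      with near_T[of n v] elim(2) show False by simp
    qed
    then show False by simp
  qed
  with y have "entry_time X D \<omega> \<le> T" unfolding entry_time_def by (intro Inf_lower) auto
  also note T
  also have "ennreal (\<delta> + of_rat s) < ennreal (\<delta> + r)"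
    using s s_less \<delta> by (simp add: ennreal_less_iff del: ennreal_plus)
  finally show ?thesis .
qed

text \<open>A hit occurs at some \<open>t > 0\<close>, and \<open>t\<close> itself serves as
  \<open>\<delta>\<^sub>0\<close>. Right-continuity keeps the path near \<open>D\<close> just after
  \<open>t\<close>, so rational times offset by any \<delta> below \<open>t\<close> detect the
  hit.\<close>

lemma hitting_imp_visits:
  assumes \<omega>: "\<omega> \<in> space M" and hit: "hitting_time X D \<omega> < ennreal \<epsilon>"
    and right: "\<And>t. t < \<infinity> \<Longrightarrow> limitin aug_top (\<lambda>s. X s \<omega>) (X t \<omega>) (at_right t)"
  shows "\<exists>\<delta>\<^sub>0>0. \<forall>\<delta>. 0 \<le> \<delta> \<and> \<delta> < \<delta>\<^sub>0 \<longrightarrow> \<theta> (ennreal \<delta>) \<omega> \<in> visits D (\<epsilon> - \<delta>)"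
proof -
  from hit obtain u where u: "0 < u" "X u \<omega> \<in> Some ` D" "u < ennreal \<epsilon>"
    unfolding hitting_time_def Inf_less_iff by blast
  then obtain t where t: "u = ennreal t" "0 \<le> t" by (cases u) auto
  have t': "0 < t" "t < \<epsilon>" using u t by (auto simp: ennreal_less_iff)
  obtain y where y: "X u \<omega> = Some y" "y \<in> D" using u(2) by blast
  have "\<exists>b>t. \<forall>u. t < u \<and> u < b \<longrightarrow> X (ennreal u) \<omega> \<in> Some ` infdist_nbhd D n" for n
  proof (rule eventually_at_right_ennrealD[OF _ t(2)])
    show "\<forall>\<^sub>F s in at_right (ennreal t). X s \<omega> \<in> Some ` infdist_nbhd D n"
      using right[of u] y subset_infdist_nbhd[of D n] unfolding t(1)[symmetric]
      by (intro limitin_aug_top_SomeD[of _ y] open_infdist_nbhd) (auto simp: t)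
  qed
  then obtain b where b: "\<And>n. t < b n"
    "\<And>n u. t < u \<Longrightarrow> u < b n \<Longrightarrow> X (ennreal u) \<omega> \<in> Some ` infdist_nbhd D n"
    by metis
  have "\<theta> (ennreal \<delta>) \<omega> \<in> visits D (\<epsilon> - \<delta>)" if \<delta>: "0 \<le> \<delta>" "\<delta> < t" for \<delta>
  proof -
    \<comment> \<open>The bound \<open>b 0\<close> makes the path lie in a neighbourhood of
      \<open>D\<close> at time \<open>s'\<close>, hence alive there.\<close>
    have "t - \<delta> < min (\<epsilon> - \<delta>) (b 0 - \<delta>)" using t' b(1)[of 0] by simp
    from of_rat_dense[OF this] obtain s' where s': "t - \<delta> < of_rat s'" "of_rat s' < \<epsilon> - \<delta>" "of_rat s' < b 0 - \<delta>"
      by auto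
    from of_rat_dense[OF s'(1)] obtain s where s: "t - \<delta> < of_rat s" "(of_rat s :: real) < of_rat s'" by blast
    have pos: "0 \<le> q" if "t - \<delta> < of_rat q" for q
    proof -
      have "(0 :: real) < of_rat q" using that \<delta> by linarith
      then show ?thesis by simp
    qed
    have "X (ennreal (\<delta> + of_rat s')) \<omega> \<in> Some ` infdist_nbhd D 0"
      using s' by (intro b(2)) auto
    then have "X (ennreal (\<delta> + of_rat s')) \<omega> \<noteq> None" by auto
    moreover have "\<exists>q. (0 \<le> q \<and> q \<le> s) \<and> X (ennreal (\<delta> + of_rat q)) \<omega> \<in> Some ` infdist_nbhd D n" for n
    proof -
      have "t - \<delta> < min (of_rat s) (b n - \<delta>)" using s b(1)[of n] by simp
      from of_rat_dense[OF this] obtain q where q: "t - \<delta> < of_rat q" "(of_rat q :: real) < of_rat s" "of_rat q < b n - \<delta>"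
        by auto
      have "X (ennreal (\<delta> + of_rat q)) \<omega> \<in> Some ` infdist_nbhd D n"
        using q by (intro b(2)) auto
      then show ?thesis using pos[OF q(1)] q(2) by (auto simp: of_rat_less)
    qed
    ultimately show ?thesis
      unfolding shift_visits_iff[OF \<omega> \<delta>(1)] using pos[OF s(1)] s(2) s'(2) by (auto simp: of_rat_less)
  qed
  then show ?thesis using t'(1) by blast
qed

section \<open>Passage to the limit at a regular point\<close>

lemma green_regular_if_strong_feller:
  assumes D: "closed D" "D \<noteq> {}" and reg: "probabilistically_regular X P D z"
    and sf: "strong_feller X P"
  shows "green_regular X P C D z"
  unfolding green_regular_def
proof (intro allI impI)
  fix \<epsilon> :: real assume \<epsilon>: "0 < \<epsilon>"
  let ?late = "\<lambda>x. {\<omega> \<in> space (P (Some x)). entry_time X D \<omega> \<ge> ennreal \<epsilon>}"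
  \<comment> \<open>Shift by \<delta> and horizon \<open>\<epsilon> - \<delta>\<close> together end
    at \<epsilon>. When \<delta> is at least \<epsilon> the event is empty, so the bound
    \<open>late_le\<close> holds for every nonnegative \<delta>.\<close>
  let ?H = "\<lambda>\<delta>. {\<omega> \<in> space M. \<theta> (ennreal \<delta>) \<omega> \<in> visits D (\<epsilon> - \<delta>)}"
  have H: "?H \<delta> \<in> sets (P y)" for \<delta> y
    using measurable_sets[OF measurable_shift visits_in_path_sigma, of "ennreal \<delta>" D "\<epsilon> - \<delta>"]
    by (simp add: sets_P vimage_def Int_def conj_commute)
  have late_le: "measure (P (Some x)) (?late x) \<le> 1 - measure (P (Some x)) (?H \<delta>)" if \<delta>: "0 \<le> \<delta>" for x \<delta>
  proof -
    interpret prob_space "P (Some x)" by (rule prob_space_P)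
    have "AE \<omega> in P (Some x). \<omega> \<in> ?late x \<longrightarrow> \<omega> \<in> space (P (Some x)) - ?H \<delta>"
      using AE_almost_surely[OF right_continuous]
        AE_almost_surely[OF quasi_left_continuous,
          OF stopping_time_rat_entry_time[of D \<delta>] incseq_rat_entry_time[of D \<delta>]] AE_space
    proof eventually_elim
      case (elim \<omega>)
      show ?case
      proof (intro impI DiffI elim(3) notI)
        assume late: "\<omega> \<in> ?late x" and "\<omega> \<in> ?H \<delta>"
        then have "entry_time X D \<omega> < ennreal (\<delta> + (\<epsilon> - \<delta>))"
          using elim(1,2) by (intro visits_imp_entry_time_less[OF _ D \<delta>]) auto
        with late show False by auto
      qed
    qed
    \<comment> \<open>Monotonicity up to a null set, with measurability supplied for the larger
      set.\<close>
    then have "prob (?late x) \<le> prob (space (P (Some x)) - ?H \<delta>)"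
      using H by (intro finite_measure_mono_AE) auto
    also have "\<dots> = 1 - prob (?H \<delta>)" using H by (rule prob_compl)
    finally show ?thesis .
  qed
  interpret prob_space "P (Some z)" by (rule prob_space_P)
  let ?d = "\<lambda>k. inverse (real (Suc k))"
  have "AE \<omega> in P (Some z). \<omega> \<in> {\<omega> \<in> space (P (Some z)). hitting_time X D \<omega> = 0}"
    using reg unfolding probabilistically_regular_def by (rule AE_prob_1)
  then have ae: "AE \<omega> in P (Some z). (\<lambda>k. indicator (?H (?d k)) \<omega> :: real) \<longlonglongrightarrow> 1"
    using AE_almost_surely[OF right_continuous]
  proof eventually_elim
    case (elim \<omega>)
    then have \<omega>: "\<omega> \<in> space M" and "hitting_time X D \<omega> < ennreal \<epsilon>" using \<epsilon> by (auto simp: space_P)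
    from hitting_imp_visits[OF this] elim(2) obtain \<delta>\<^sub>0 where \<delta>\<^sub>0: "0 < \<delta>\<^sub>0"
      "\<And>\<delta>. 0 \<le> \<delta> \<Longrightarrow> \<delta> < \<delta>\<^sub>0 \<Longrightarrow> \<theta> (ennreal \<delta>) \<omega> \<in> visits D (\<epsilon> - \<delta>)" by blast
    have "\<forall>\<^sub>F k in sequentially. ?d k < \<delta>\<^sub>0"
      by (rule order_tendstoD(2)[OF LIMSEQ_inverse_real_of_nat \<delta>\<^sub>0(1)])
    then have "\<forall>\<^sub>F k in sequentially. (indicator (?H (?d k)) \<omega> :: real) = 1"
      by eventually_elim (use \<omega> \<delta>\<^sub>0(2) in auto)
    then show ?case by (rule tendsto_eventually)
  qed
  \<comment> \<open>Each regular path has its own threshold \<open>\<delta>\<^sub>0\<close>;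
    dominated convergence turns these pathwise limits into a limit of probabilities.\<close>
  have "(\<lambda>k. \<integral>\<omega>. indicator (?H (?d k)) \<omega> \<partial>P (Some z)) \<longlonglongrightarrow> (\<integral>\<omega>. (1::real) \<partial>P (Some z))"
  proof (rule integral_dominated_convergence[where w="\<lambda>_. 1"])
    show "indicator (?H (?d k)) \<in> borel_measurable (P (Some z))" for k
      by (rule borel_measurable_indicator[OF H])
    show "AE \<omega> in P (Some z). norm (indicator (?H (?d k)) \<omega> :: real) \<le> 1" for k
      by (rule AE_I2) (simp add: indicator_le_1)
    show "AE \<omega> in P (Some z). (\<lambda>k. indicator (?H (?d k)) \<omega> :: real) \<longlonglongrightarrow> 1" by (rule ae)
  qed (rule borel_measurable_const, rule integrable_const)
  moreover have "(\<integral>\<omega>. indicator (?H (?d k)) \<omega> \<partial>P (Some z)) = prob (?H (?d k))" for k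
    using sets.sets_into_space[OF H[of "?d k" "Some z"]] by (simp add: Int_absorb2)
  ultimately have lim: "(\<lambda>k. prob (?H (?d k))) \<longlonglongrightarrow> 1"
    by (simp add: prob_space)
  show "((\<lambda>x. measure (P (Some x)) (?late x)) \<longlongrightarrow> 0) (at z within C)"
  proof (rule order_tendstoI)
    fix e :: real assume "0 < e"
    then have "\<forall>\<^sub>F k in sequentially. 1 - e < prob (?H (?d k))"
      by (intro order_tendstoD(1)[OF lim]) simp
    then obtain k where k: "1 - e < prob (?H (?d k))"
      using eventually_happens'[OF sequentially_bot] by blast
    \<comment> \<open>With \<open>k\<close> now fixed, continuity carries the strict bound at
      \<open>z\<close> to all nearby starting points.\<close>
    have "continuous_on UNIV (\<lambda>x. measure (P (Some x)) (?H (?d k)))"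
      by (rule continuous_on_visits[OF sf]) simp
    then have "continuous (at z within C) (\<lambda>x. measure (P (Some x)) (?H (?d k)))"
      by (simp only: continuous_on_eq_continuous_at[OF open_UNIV] continuous_at_imp_continuous_at_within ball_UNIV)
    then have "((\<lambda>x. measure (P (Some x)) (?H (?d k))) \<longlongrightarrow> prob (?H (?d k))) (at z within C)"
      by (simp only: continuous_within)
    from order_tendstoD(1)[OF this k]
    show "\<forall>\<^sub>F x in at z within C. measure (P (Some x)) (?late x) < e"
    proof eventually_elim
      case (elim x)
      with late_le[of "?d k" x] show ?case by simp
    qed
  next
    fix e :: real assume "e < 0"
    then show "\<forall>\<^sub>F x in at z within C. e < measure (P (Some x)) (?late x)"
      by (intro always_eventually allI) (rule less_le_trans[OF _ measure_nonneg])
  qed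
qed

end

theorem corollary2:
  fixes M :: "'w measure"
    and F :: "ennreal \<Rightarrow> 'w measure"
    and X :: "ennreal \<Rightarrow> 'w \<Rightarrow> 'a::euclidean_space option"
    and \<theta> :: "ennreal \<Rightarrow> 'w \<Rightarrow> 'w"
    and P :: "'a option \<Rightarrow> 'w measure"
    and C D :: "'a set"
    and x :: 'a
  assumes "standard_process M F X \<theta> P"
    and "open C"
    and "D = UNIV - C"
    and "x \<in> frontier C"
    and "probabilistically_regular X P D x"
    and "strong_feller X P"
  shows "green_regular X P C D x"
proof -
  interpret standard_process M F X \<theta> P by (rule assms)
  have "closed D" using assms by (simp add: Compl_eq_Diff_UNIV[symmetric] closed_Compl)
  \<comment> \<open>The existence of a boundary point excludes \<open>C = UNIV\<close>, whose
    frontier is empty.\<close>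
  moreover have "D \<noteq> {}"
  proof
    assume "D = {}"
    then have "C = UNIV" using assms(3) by auto
    with assms(4) show False by simp
  qed
  ultimately show ?thesis using assms by (intro green_regular_if_strong_feller)
qed

end
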